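(* (i) For $x>0$, $$I_{\nu}(x)\mathbf{L}_{\nu-1}(x)-I_{\nu-1}(x)\mathbf{L}_{\nu}(x)>0,\quad \nu\geq-\tfrac{1}{2},$$ $$I_{\nu}(x)\mathbf{L}_{\nu-1}(x)-I_{\nu-1}(x)\mathbf{L}_{\nu}(x)<a_\nu(x)I_{\nu}(x),\quad \nu\geq-\tfrac{3}{2},$$ $$I_{\nu}(x)\mathbf{L}_{\nu-1}(x)-I_{\nu-1}(x)\mathbf{L}_{\nu}(x)<a_{\nu-1}(x)I_{\nu-1}(x),\quad \nu\geq\tfrac{1}{2}.$$ (ii) Let $\nu\geq0$. Then, for $x>0$, $$\bigg(\frac{I_{\nu-1}(x)}{I_\nu(x)}+\frac{2b_\nu(x)}{x}\bigg)^{-1}<\frac{\mathbf{L}_{\nu}(x)}{\mathbf{L}_{\nu-1}(x)}<\frac{I_{\nu}(x)}{I_{\nu-1}(x)}.$$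
   Context: For real $\nu$ and $x>0$, the modified Bessel function of the first kind and the modified Struve function of the first kind are $$I_\nu(x)=\sum_{k=0}^\infty\frac{(\frac{1}{2}x)^{2k+\nu}}{k!\,\Gamma(k+\nu+1)},\qquad \mathbf{L}_\nu(x)=\sum_{k=0}^\infty\frac{(\frac{1}{2}x)^{2k+\nu+1}}{\Gamma(k+\frac{3}{2})\Gamma(k+\nu+\frac{3}{2})},$$ where $1/\Gamma(z)$ is interpreted as $0$ for $z=0,-1,-2,\ldots$. Define $$a_\nu(x)=\frac{(x/2)^\nu}{\sqrt{\pi}\,\Gamma(\nu+\frac{3}{2})}\quad\text{(where } a_{-3/2}(x)=0),\qquad b_\nu(x)=\frac{x\,a_\nu(x)}{2\,\mathbf{L}_\nu(x)}.$$ *)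

theory Defs
  imports "HOL-Analysis.Gamma_Function"
begin

text \<open>
  Modified Bessel and modified Struve functions of the first kind, of real order \<open>\<nu>\<close>, for
  positive argument \<open>x\<close>. \<^const>\<open>rGamma\<close> is the entire function \<open>1/\<Gamma>\<close>, so it vanishes at the
  poles \<open>0, -1, -2, \<dots>\<close> of \<open>\<Gamma>\<close>, as the series require.
\<close>

definition bessel_I :: "real \<Rightarrow> real \<Rightarrow> real" where
  "bessel_I \<nu> x = (\<Sum>k. (x / 2) powr (2 * real k + \<nu>) / fact k * rGamma (real k + \<nu> + 1))"

definition struve_L :: "real \<Rightarrow> real \<Rightarrow> real" where
  "struve_L \<nu> x =
     (\<Sum>k. (x / 2) powr (2 * real k + \<nu> + 1) * rGamma (real k + 3 / 2) * rGamma (real k + \<nu> + 3 / 2))"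

text \<open>Since \<open>rGamma 0 = 0\<close>, the convention \<open>struve_a (-3/2) x = 0\<close> is built in.\<close>

definition struve_a :: "real \<Rightarrow> real \<Rightarrow> real" where
  "struve_a \<nu> x = (x / 2) powr \<nu> / sqrt pi * rGamma (\<nu> + 3 / 2)"

definition struve_b :: "real \<Rightarrow> real \<Rightarrow> real" where
  "struve_b \<nu> x = x * struve_a \<nu> x / (2 * struve_L \<nu> x)"

end

(* The Cauchy product of the defining series gives
   I_\<nu> L_{\<nu>-1} - I_{\<nu>-1} L_\<nu> = (x/2)^{2\<nu>} \<Sum>_n c_n (x/2)^{2n}, where c_n is a finite sum that telescopes to
   c_n = 1 / ((n + \<nu> + 1/2) n! \<Gamma>(n+\<nu>+1) \<Gamma>(1/2) \<Gamma>(\<nu>+1/2)).  For \<nu> \<ge> -1/2 these are nonnegative and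
   c_0 > 0 (computed directly, as the closed form is 0/0 at n = 0, \<nu> = -1/2), which is the first
   inequality.  The three-term recurrences of I and L turn the cross product at \<nu> into a_\<nu> I_\<nu> minus
   the cross product at \<nu> + 1, so all other bounds are the first inequality with a shifted order. *)
theory Submission imports Defs begin

text \<open>Common shape of both functions: at z = (x/2)^2 and up to a power of x/2, the choice a =
  1, b = \<nu> + 1 gives I of order \<nu>, and a = 3/2, b = \<nu> + 3/2 gives L of order
  \<nu>.\<close>

definition rGamma2_series :: "real \<Rightarrow> real \<Rightarrow> real \<Rightarrow> real" where
  "rGamma2_series a b z = (\<Sum>k. rGamma (real k + a) * rGamma (real k + b) * z ^ k)"

section \<open>Reciprocal Gamma function at real arguments\<close>

lemma rGamma_real_pos:
  fixes t :: real
  assumes "t > 0"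
  shows "rGamma t > 0"
  using assms by (simp add: rGamma_inverse_Gamma)

lemma rGamma_real_nonneg:
  fixes t :: real
  assumes "t \<ge> 0"
  shows "rGamma t \<ge> 0"
  using assms rGamma_real_pos[of t] by (cases "t = 0") auto

lemma rGamma_rec:
  fixes t :: real
  shows "rGamma t = t * rGamma (t + 1)"
  by (rule rGamma_plus1[symmetric])

lemma rGamma_half: "rGamma (1/2 :: real) = 1 / sqrt pi"
  by (simp add: rGamma_inverse_Gamma Gamma_one_half_real inverse_eq_divide)

section \<open>Convergence, positivity and recurrence of the common series\<close>

lemma summable_norm_rGamma2_series:
  fixes a b z :: real
  shows "summable (\<lambda>k. norm (rGamma (real k + a) * rGamma (real k + b) * z ^ k))"
proof (rule summable_ratio_test[where c = "1/2"])
  \<comment> \<open>Beyond this bound n + a \<ge> 2|z| and n + b \<ge> 1, so the ratio of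
    consecutive terms, z / ((n + a)(n + b)), is at most 1/2 in absolute value.\<close>
  define N where "N = nat \<lceil>\<bar>a\<bar> + \<bar>b\<bar> + 2 * \<bar>z\<bar> + 1\<rceil>"
  fix n assume "n \<ge> N"
  then have n: "real n \<ge> \<bar>a\<bar> + \<bar>b\<bar> + 2 * \<bar>z\<bar> + 1"
    unfolding N_def by linarith
  let ?f = "\<lambda>k. rGamma (real k + a) * rGamma (real k + b) * z ^ k"
  have rec: "rGamma (real n + a) = (real n + a) * rGamma (real (Suc n) + a)"
    "rGamma (real n + b) = (real n + b) * rGamma (real (Suc n) + b)"
    using rGamma_rec[of "real n + a"] rGamma_rec[of "real n + b"] by (simp_all add: add_ac)
  have "2 * \<bar>z\<bar> \<le> real n + a" "1 \<le> real n + b"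
    using n by linarith+
  then have "2 * \<bar>z\<bar> * 1 \<le> (real n + a) * (real n + b)"
    by (intro mult_mono) auto
  moreover have "\<bar>(real n + a) * (real n + b)\<bar> = (real n + a) * (real n + b)"
    using n by (intro abs_of_nonneg mult_nonneg_nonneg) linarith+
  ultimately have key: "\<bar>z\<bar> \<le> 1/2 * \<bar>(real n + a) * (real n + b)\<bar>"
    by linarith
  define q where "q = \<bar>rGamma (real (Suc n) + a) * rGamma (real (Suc n) + b) * z ^ n\<bar>"
  have "norm (?f (Suc n)) = \<bar>z\<bar> * q"
    by (simp add: q_def abs_mult mult_ac)
  also have "\<dots> \<le> 1/2 * \<bar>(real n + a) * (real n + b)\<bar> * q"
    by (rule mult_right_mono[OF key]) (simp add: q_def)
  also have "\<dots> = 1/2 * norm (?f n)"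
    by (simp only: rec q_def abs_mult real_norm_def mult_ac)
  finally show "norm (norm (?f (Suc n))) \<le> 1/2 * norm (norm (?f n))"
    by simp
qed simp

lemma rGamma2_series_sums:
  "(\<lambda>k. rGamma (real k + a) * rGamma (real k + b) * z ^ k) sums rGamma2_series a b z"
  unfolding rGamma2_series_def
  by (rule summable_sums[OF summable_norm_cancel[OF summable_norm_rGamma2_series]])

lemma rGamma2_series_pos:
  assumes "a > 0" "b \<ge> 0" "z > 0"
  shows "rGamma2_series a b z > 0"
  unfolding rGamma2_series_def
\<comment> \<open>At b = 0 the term for k = 0 vanishes because \<open>rGamma 0 = 0\<close>, so
  strictness comes from k = 1.\<close>
proof (rule suminf_pos2[OF summable_norm_cancel[OF summable_norm_rGamma2_series], where i = 1])
  show "0 \<le> rGamma (real n + a) * rGamma (real n + b) * z ^ n" for n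
    using assms by (simp add: rGamma_real_nonneg)
  show "0 < rGamma (real 1 + a) * rGamma (real 1 + b) * z ^ 1"
    using assms by (simp add: rGamma_real_pos)
qed

text \<open>Coefficientwise this is k + b = (k + a - 1) + (b - a + 1). Absorbing the factor z shifts
  the first series by one index, and the missing initial term is the product of
  \<open>rGamma\<close> values at the end. That product vanishes for a = 1 and becomes the source of
  \<open>struve_a\<close> for a = 3/2.\<close>

lemma rGamma2_series_rec:
  "rGamma2_series a b z =
     z * rGamma2_series a (b + 2) z + (b - a + 1) * rGamma2_series a (b + 1) z
       + rGamma (a - 1) * rGamma (b + 1)"
proof -
  let ?f = "\<lambda>k. rGamma (real k + (a - 1)) * rGamma (real k + (b + 1)) * z ^ k"
  have "(\<lambda>k. z * (rGamma (real k + a) * rGamma (real k + (b + 2)) * z ^ k))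
          sums (z * rGamma2_series a (b + 2) z)"
    by (intro sums_mult rGamma2_series_sums)
  then have "(\<lambda>k. ?f (Suc k)) sums (z * rGamma2_series a (b + 2) z)"
    by (simp add: algebra_simps)
  then have shifted: "?f sums (z * rGamma2_series a (b + 2) z + rGamma (a - 1) * rGamma (b + 1))"
    by (subst (asm) sums_Suc_iff) simp
  have "(\<lambda>k. ?f k + (b - a + 1) * (rGamma (real k + a) * rGamma (real k + (b + 1)) * z ^ k)) sums
      (z * rGamma2_series a (b + 2) z + rGamma (a - 1) * rGamma (b + 1)
        + (b - a + 1) * rGamma2_series a (b + 1) z)"
    by (intro sums_add shifted sums_mult rGamma2_series_sums)
  moreover have "?f k + (b - a + 1) * (rGamma (real k + a) * rGamma (real k + (b + 1)) * z ^ k)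
      = rGamma (real k + a) * rGamma (real k + b) * z ^ k" for k
  proof -
    have "rGamma (real k + (a - 1)) = (real k + (a - 1)) * rGamma (real k + a)"
      "rGamma (real k + b) = (real k + b) * rGamma (real k + (b + 1))"
      using rGamma_rec[of "real k + (a - 1)"] rGamma_rec[of "real k + b"]
      by (simp_all only: add.assoc diff_add_cancel)
    then show ?thesis
      by (simp only:) (simp only: algebra_simps)
  qed
  ultimately show ?thesis
    using sums_unique2[OF rGamma2_series_sums[of a b z]] by simp
qed

section \<open>Coefficients of the cross product\<close>

lemma cross_coeff_telescope:
  fixes \<nu> :: real
  shows "(real n + 1/2 + \<nu>) *
    (\<Sum>i\<le>n. rGamma (real i + 1) * rGamma (real i + (\<nu> + 1)) *
              (rGamma (real (n - i) + 3/2) * rGamma (real (n - i) + (\<nu> + 1/2)))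
          - rGamma (real i + 1) * rGamma (real i + \<nu>) *
              (rGamma (real (n - i) + 3/2) * rGamma (real (n - i) + (\<nu> + 3/2))))
    = rGamma (real n + 1) * rGamma (real n + 1 + \<nu>) * rGamma (1/2) * rGamma (\<nu> + 1/2)"
    (is "?N * (\<Sum>i\<le>n. ?c i) = _")
proof -
  \<comment> \<open>the antidifference of the summand, found as in Gosper's algorithm\<close>
  define T where "T i = rGamma (real i) * rGamma (real i + \<nu>) *
      rGamma (real n - real i + 3/2) * rGamma (real n - real i + 3/2 + \<nu>)" for i
  have "?N * ?c i = T (Suc i) - T i" if "i \<le> n" for i
  proof -
    define p q r s where "p = rGamma (real i + 1)" and "q = rGamma (real i + \<nu> + 1)"
      and "r = rGamma (real n - real i + 3/2)" and "s = rGamma (real n - real i + 3/2 + \<nu>)"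
    have "rGamma (real i) = real i * p" "rGamma (real i + \<nu>) = (real i + \<nu>) * q"
      "rGamma (real n - real i + 1/2) = (real n - real i + 1/2) * r"
      "rGamma (real n - real i + 1/2 + \<nu>) = (real n - real i + 1/2 + \<nu>) * s"
    proof -
      have shift: "real n - real i + 3/2 = real n - real i + 1/2 + 1"
        "real n - real i + 1/2 + 1 + \<nu> = real n - real i + 1/2 + \<nu> + 1"
        by simp_all
      show "rGamma (real i) = real i * p" "rGamma (real i + \<nu>) = (real i + \<nu>) * q"
        "rGamma (real n - real i + 1/2) = (real n - real i + 1/2) * r"
        "rGamma (real n - real i + 1/2 + \<nu>) = (real n - real i + 1/2 + \<nu>) * s"
        unfolding p_def q_def r_def s_def shift by (rule rGamma_rec)+
    qed
    then have T: "T (Suc i) = p * q * ((real n - real i + 1/2) * r) * ((real n - real i + 1/2 + \<nu>) * s)"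
      "T i = real i * p * ((real i + \<nu>) * q) * r * s"
      and c: "?c i = p * q * (r * ((real n - real i + 1/2 + \<nu>) * s)) - p * ((real i + \<nu>) * q) * (r * s)"
      using that by (simp_all add: T_def p_def q_def r_def s_def of_nat_diff add_ac diff_add_eq)
    \<comment> \<open>With v = n - i + 1/2, removing the common factor p q r s leaves (i + v +
      \<nu>)(v - i) = v(v + \<nu>) - i(i + \<nu>).\<close>
    show ?thesis
      unfolding T c by algebra
  qed
  then have "?N * (\<Sum>i\<le>n. ?c i) = (\<Sum>i\<le>n. T (Suc i) - T i)"
    unfolding sum_distrib_left by (intro sum.cong) auto
  also have "\<dots> = T (Suc n) - T 0"
    using sum_lessThan_telescope[of T "Suc n"] by (simp only: lessThan_Suc_atMost)
  \<comment> \<open>\<open>T 0\<close> vanishes through its factor \<open>rGamma 0\<close>; in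
    \<open>T (Suc n)\<close> the last two arguments are 1/2 and \<nu> + 1/2.\<close>
  finally show ?thesis
    by (simp add: T_def add_ac)
qed

lemma rGamma2_series_cross_pos:
  fixes \<nu> z :: real
  assumes \<nu>: "\<nu> \<ge> -1/2" and z: "z > 0"
  shows "rGamma2_series 1 (\<nu> + 1) z * rGamma2_series (3/2) (\<nu> + 1/2) z
       - rGamma2_series 1 \<nu> z * rGamma2_series (3/2) (\<nu> + 3/2) z > 0"
proof -
  define c where "c n =
    (\<Sum>i\<le>n. rGamma (real i + 1) * rGamma (real i + (\<nu> + 1)) *
              (rGamma (real (n - i) + 3/2) * rGamma (real (n - i) + (\<nu> + 1/2)))
          - rGamma (real i + 1) * rGamma (real i + \<nu>) *
              (rGamma (real (n - i) + 3/2) * rGamma (real (n - i) + (\<nu> + 3/2))))" for n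
  have prod: "(\<lambda>n. \<Sum>i\<le>n. rGamma (real i + a) * rGamma (real i + b) * z ^ i *
      (rGamma (real (n - i) + a') * rGamma (real (n - i) + b') * z ^ (n - i)))
      sums (rGamma2_series a b z * rGamma2_series a' b' z)" for a b a' b'
    unfolding rGamma2_series_def
    by (intro Cauchy_product_sums summable_norm_rGamma2_series)
  have zpow: "z ^ i * z ^ (n - i) = z ^ n" if "i \<le> n" for i n
    using that by (simp flip: power_add)
  have coeff: "(\<Sum>i\<le>n. A i * B i * z ^ i * (C i * D i * z ^ (n - i)))
      = (\<Sum>i\<le>n. A i * B i * (C i * D i)) * z ^ n" for A B C D :: "nat \<Rightarrow> real" and n
    unfolding sum_distrib_right
    by (intro sum.cong refl) (simp add: zpow[symmetric] mult_ac)
  have sums: "(\<lambda>n. c n * z ^ n) sums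
      (rGamma2_series 1 (\<nu> + 1) z * rGamma2_series (3/2) (\<nu> + 1/2) z
       - rGamma2_series 1 \<nu> z * rGamma2_series (3/2) (\<nu> + 3/2) z)"
    using sums_diff[OF prod[of 1 "\<nu> + 1" "3/2" "\<nu> + 1/2"] prod[of 1 \<nu> "3/2" "\<nu> + 3/2"]]
    unfolding coeff by (simp add: c_def sum_subtractf left_diff_distrib)
  have c0: "c 0 > 0"
  proof -
    \<comment> \<open>The two products differ only by the weights \<nu> + 1/2 and \<nu>, whose
      difference is 1/2.\<close>
    have "c 0 = 1/2 * rGamma (\<nu> + 1) * rGamma (3/2) * rGamma (\<nu> + 3/2)"
    proof -
      have "rGamma (\<nu> + 1/2) = (\<nu> + 1/2) * rGamma (\<nu> + 3/2)"
        using rGamma_rec[of "\<nu> + 1/2"] by (simp add: add.assoc)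
      moreover have "rGamma \<nu> = \<nu> * rGamma (\<nu> + 1)"
        by (rule rGamma_rec)
      ultimately show ?thesis
        by (simp add: c_def) (simp only: algebra_simps)
    qed
    also have "\<dots> > 0"
      using \<nu> by (intro mult_pos_pos rGamma_real_pos) auto
    finally show ?thesis .
  qed
  have c_nonneg: "c n \<ge> 0" for n
  proof (cases n)
    case 0
    then show ?thesis using c0 by simp
  next
    case (Suc m)
    \<comment> \<open>For n \<ge> 1 the factor n + 1/2 + \<nu> is strictly positive even at \<nu> =
      -1/2, so \<open>c n\<close> inherits the sign of the telescoped value.\<close>
    have "(real n + 1/2 + \<nu>) * c n \<ge> 0"
      unfolding c_def cross_coeff_telescope using \<nu> by (simp add: rGamma_real_nonneg)
    moreover have "real n + 1/2 + \<nu> > 0"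
      using \<nu> Suc by simp
    ultimately show ?thesis
      by (simp add: zero_le_mult_iff)
  qed
  \<comment> \<open>Strictness rests on \<open>c 0\<close> alone: at \<nu> = -1/2 all later
    coefficients vanish, since \<nu> + 1/2 = 0.\<close>
  have "0 < (\<Sum>n. c n * z ^ n)"
    by (rule suminf_pos2[OF sums_summable[OF sums], where i = 0]) (use c0 c_nonneg z in auto)
  then show ?thesis
    using sums_unique[OF sums] by simp
qed

section \<open>Bessel and Struve functions through the common series\<close>

lemma bessel_I_eq_rGamma2_series:
  assumes "x > 0"
  shows "bessel_I \<nu> x = (x/2) powr \<nu> * rGamma2_series 1 (\<nu> + 1) ((x/2)\<^sup>2)"
proof -
  have "(x/2) powr (2 * real k + \<nu>) / fact k * rGamma (real k + \<nu> + 1) =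
      (x/2) powr \<nu> * (rGamma (real k + 1) * rGamma (real k + (\<nu> + 1)) * ((x/2)\<^sup>2) ^ k)" for k
  proof -
    have "(x/2) powr (2 * real k) = ((x/2)\<^sup>2) ^ k"
      using assms powr_realpow[of "x/2" "2 * k"] by (simp add: power_mult)
    moreover have "rGamma (real k + 1) = 1 / fact k"
      using Gamma_fact[of k, where ?'a = real] by (simp add: rGamma_inverse_Gamma divide_inverse add_ac)
    ultimately show ?thesis
      by (simp add: powr_add mult_ac add_ac)
  qed
  note coeff = this
  show ?thesis
    unfolding bessel_I_def rGamma2_series_def coeff
    by (rule suminf_mult[OF summable_norm_cancel[OF summable_norm_rGamma2_series]])
qed

lemma struve_L_eq_rGamma2_series:
  assumes "x > 0"
  shows "struve_L \<nu> x = (x/2) powr (\<nu> + 1) * rGamma2_series (3/2) (\<nu> + 3/2) ((x/2)\<^sup>2)"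
proof -
  have "(x/2) powr (2 * real k + \<nu> + 1) * rGamma (real k + 3/2) * rGamma (real k + \<nu> + 3/2) =
      (x/2) powr (\<nu> + 1) * (rGamma (real k + 3/2) * rGamma (real k + (\<nu> + 3/2)) * ((x/2)\<^sup>2) ^ k)" for k
  proof -
    have "(x/2) powr (2 * real k) = ((x/2)\<^sup>2) ^ k"
      using assms powr_realpow[of "x/2" "2 * k"] by (simp add: power_mult)
    moreover have "(x/2) powr (2 * real k + \<nu> + 1) = (x/2) powr (2 * real k) * (x/2) powr (\<nu> + 1)"
      by (simp add: add.assoc flip: powr_add)
    ultimately show ?thesis
      by (simp add: mult_ac add_ac)
  qed
  note coeff = this
  show ?thesis
    unfolding struve_L_def rGamma2_series_def coeff
    by (rule suminf_mult[OF summable_norm_cancel[OF summable_norm_rGamma2_series]])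
qed

definition bessel_struve_cross :: "real \<Rightarrow> real \<Rightarrow> real" where
  "bessel_struve_cross \<nu> x =
     bessel_I \<nu> x * struve_L (\<nu> - 1) x - bessel_I (\<nu> - 1) x * struve_L \<nu> x"

text \<open>Both products carry the same power of x/2, with exponent 2\<nu>, so the sign is that of
  the cross product of the series.\<close>

lemma bessel_struve_cross_pos:
  assumes "x > 0" "\<nu> \<ge> -1/2"
  shows "bessel_struve_cross \<nu> x > 0"
proof -
  let ?z = "(x/2)\<^sup>2"
  have idx: "\<nu> - 1 + 1 = \<nu>" "\<nu> - 1 + 3/2 = \<nu> + 1/2"
    by simp_all
  have "(x/2) powr (\<nu> - 1) * (x/2) powr (\<nu> + 1) = (x/2) powr \<nu> * (x/2) powr \<nu>"
    by (simp flip: powr_add)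
  then have "bessel_I (\<nu> - 1) x * struve_L \<nu> x = (x/2) powr \<nu> * (x/2) powr \<nu> *
      (rGamma2_series 1 \<nu> ?z * rGamma2_series (3/2) (\<nu> + 3/2) ?z)"
    unfolding bessel_I_eq_rGamma2_series[OF assms(1)] struve_L_eq_rGamma2_series[OF assms(1)] idx
    by algebra
  moreover have "bessel_I \<nu> x * struve_L (\<nu> - 1) x = (x/2) powr \<nu> * (x/2) powr \<nu> *
      (rGamma2_series 1 (\<nu> + 1) ?z * rGamma2_series (3/2) (\<nu> + 1/2) ?z)"
    unfolding bessel_I_eq_rGamma2_series[OF assms(1)] struve_L_eq_rGamma2_series[OF assms(1)] idx
    by (simp only: mult_ac)
  ultimately have "bessel_struve_cross \<nu> x = (x/2) powr \<nu> * (x/2) powr \<nu> *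
      (rGamma2_series 1 (\<nu> + 1) ?z * rGamma2_series (3/2) (\<nu> + 1/2) ?z
       - rGamma2_series 1 \<nu> ?z * rGamma2_series (3/2) (\<nu> + 3/2) ?z)"
    by (simp only: bessel_struve_cross_def right_diff_distrib)
  also have "\<dots> > 0"
    using assms by (intro mult_pos_pos rGamma2_series_cross_pos) auto
  finally show ?thesis .
qed

section \<open>Three-term recurrences in the order\<close>

lemma bessel_I_rec:
  assumes "x > 0"
  shows "bessel_I (\<nu> - 1) x = bessel_I (\<nu> + 1) x + 2 * \<nu> / x * bessel_I \<nu> x"
proof -
  define w G where "w = (x/2) powr (\<nu> - 1)" and "G b = rGamma2_series 1 b ((x/2)\<^sup>2)" for b
  have powr: "(x/2) powr \<nu> = w * (x/2)" "(x/2) powr (\<nu> + 1) = w * (x/2)\<^sup>2"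
    using assms by (simp_all add: w_def powr_add powr_diff power2_eq_square)
  have I: "bessel_I (\<nu> - 1) x = w * G \<nu>" "bessel_I \<nu> x = w * (x/2) * G (\<nu> + 1)"
    "bessel_I (\<nu> + 1) x = w * (x/2)\<^sup>2 * G (\<nu> + 2)"
    using powr by (simp_all add: bessel_I_eq_rGamma2_series[OF assms] w_def G_def add.assoc)
  \<comment> \<open>For a = 1 the boundary term contains \<open>rGamma 0\<close>, so this recurrence
    is homogeneous.\<close>
  have "G \<nu> = (x/2)\<^sup>2 * G (\<nu> + 2) + \<nu> * G (\<nu> + 1)"
    using rGamma2_series_rec[of 1 \<nu> "(x/2)\<^sup>2"] by (simp add: G_def)
  then show ?thesis
    unfolding I using assms by (simp add: distrib_left)
qed

text \<open>Here a = 3/2, and the boundary term \<open>rGamma (1/2) * rGamma (\<nu> + 3/2)\<close>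
  survives; times the power of x/2 it is \<open>struve_a\<close>.\<close>

lemma struve_L_rec:
  assumes "x > 0"
  shows "struve_L (\<nu> - 1) x = struve_L (\<nu> + 1) x + 2 * \<nu> / x * struve_L \<nu> x + struve_a \<nu> x"
proof -
  define w G where "w = (x/2) powr \<nu>" and "G b = rGamma2_series (3/2) b ((x/2)\<^sup>2)" for b
  have powr: "(x/2) powr (\<nu> + 1) = w * (x/2)" "(x/2) powr (\<nu> + 2) = w * (x/2)\<^sup>2"
    using assms by (simp_all add: w_def powr_add)
  have idx: "\<nu> - 1 + 1 = \<nu>" "\<nu> + 1 + 1 = \<nu> + 2"
    "\<nu> - 1 + 3/2 = \<nu> + 1/2" "\<nu> + 1 + 3/2 = \<nu> + 5/2"
    by simp_all
  have L: "struve_L (\<nu> - 1) x = w * G (\<nu> + 1/2)" "struve_L \<nu> x = w * (x/2) * G (\<nu> + 3/2)"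
    "struve_L (\<nu> + 1) x = w * (x/2)\<^sup>2 * G (\<nu> + 5/2)"
    unfolding struve_L_eq_rGamma2_series[OF assms] G_def idx powr by (simp_all only: w_def)
  have "\<nu> + 1/2 + 2 = \<nu> + 5/2" "\<nu> + 1/2 + 1 = \<nu> + 3/2" "\<nu> + 1/2 - 3/2 + 1 = \<nu>" "3/2 - 1 = (1/2::real)"
    by simp_all
  then have "G (\<nu> + 1/2) = (x/2)\<^sup>2 * G (\<nu> + 5/2) + \<nu> * G (\<nu> + 3/2) + rGamma (\<nu> + 3/2) / sqrt pi"
    using rGamma2_series_rec[of "3/2" "\<nu> + 1/2" "(x/2)\<^sup>2"] unfolding G_def by (simp only: rGamma_half) simp
  then show ?thesis
    unfolding L struve_a_def w_def[symmetric] using assms by (simp add: distrib_left)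
qed

text \<open>The 2\<nu>/x terms of the two recurrences cancel. Positivity at order \<nu> + 1 thus
  becomes an upper bound at order \<nu>.\<close>

lemma bessel_struve_cross_rec:
  assumes "x > 0"
  shows "bessel_struve_cross \<nu> x = struve_a \<nu> x * bessel_I \<nu> x - bessel_struve_cross (\<nu> + 1) x"
  unfolding bessel_struve_cross_def bessel_I_rec[OF assms, of \<nu>] struve_L_rec[OF assms, of \<nu>]
  by (simp add: algebra_simps)

text \<open>The endpoint -1 matters: it is the order \<nu> - 1 in part (ii) when \<nu> = 0.\<close>

lemma bessel_I_pos:
  assumes "x > 0" "\<nu> \<ge> -1"
  shows "bessel_I \<nu> x > 0"
  using assms by (simp add: bessel_I_eq_rGamma2_series rGamma2_series_pos)

lemma struve_L_pos:
  assumes "x > 0" "\<nu> \<ge> -3/2"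
  shows "struve_L \<nu> x > 0"
  using assms by (simp add: struve_L_eq_rGamma2_series rGamma2_series_pos)

theorem corollary3p5:
  fixes \<nu> x :: real
  assumes "x > 0"
  shows
    "(\<nu> \<ge> - (1/2) \<longrightarrow>
        bessel_I \<nu> x * struve_L (\<nu> - 1) x - bessel_I (\<nu> - 1) x * struve_L \<nu> x > 0)
   \<and> (\<nu> \<ge> - (3/2) \<longrightarrow>
        bessel_I \<nu> x * struve_L (\<nu> - 1) x - bessel_I (\<nu> - 1) x * struve_L \<nu> x
          < struve_a \<nu> x * bessel_I \<nu> x)
   \<and> (\<nu> \<ge> 1/2 \<longrightarrow>
        bessel_I \<nu> x * struve_L (\<nu> - 1) x - bessel_I (\<nu> - 1) x * struve_L \<nu> x
          < struve_a (\<nu> - 1) x * bessel_I (\<nu> - 1) x)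
   \<and> (\<nu> \<ge> 0 \<longrightarrow>
        inverse (bessel_I (\<nu> - 1) x / bessel_I \<nu> x + 2 * struve_b \<nu> x / x)
          < struve_L \<nu> x / struve_L (\<nu> - 1) x
      \<and> struve_L \<nu> x / struve_L (\<nu> - 1) x < bessel_I \<nu> x / bessel_I (\<nu> - 1) x)"
proof (intro conjI impI)
  show "0 < bessel_I \<nu> x * struve_L (\<nu> - 1) x - bessel_I (\<nu> - 1) x * struve_L \<nu> x"
    if "\<nu> \<ge> - (1/2)"
    using bessel_struve_cross_pos[OF assms, of \<nu>] that by (simp add: bessel_struve_cross_def)
  show upper: "bessel_I \<nu> x * struve_L (\<nu> - 1) x - bessel_I (\<nu> - 1) x * struve_L \<nu> x
      < struve_a \<nu> x * bessel_I \<nu> x" if "\<nu> \<ge> - (3/2)"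
    using bessel_struve_cross_pos[OF assms, of "\<nu> + 1"] bessel_struve_cross_rec[OF assms, of \<nu>] that
    by (simp add: bessel_struve_cross_def)
  \<comment> \<open>The recurrence is read backwards: at order \<nu> - 1 it expresses the cross
    product at \<nu> as \<open>struve_a (\<nu> - 1) x * bessel_I (\<nu> - 1) x\<close> minus the one
    at \<nu> - 1, which is positive for \<nu> \<ge> 1/2.\<close>
  show "bessel_I \<nu> x * struve_L (\<nu> - 1) x - bessel_I (\<nu> - 1) x * struve_L \<nu> x
      < struve_a (\<nu> - 1) x * bessel_I (\<nu> - 1) x" if "\<nu> \<ge> 1/2"
    using bessel_struve_cross_pos[OF assms, of "\<nu> - 1"] bessel_struve_cross_rec[OF assms, of "\<nu> - 1"] that
    by (simp add: bessel_struve_cross_def)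
  assume \<nu>: "\<nu> \<ge> 0"
  define I0 I1 L0 L1 where "I0 = bessel_I \<nu> x" and "I1 = bessel_I (\<nu> - 1) x"
    and "L0 = struve_L \<nu> x" and "L1 = struve_L (\<nu> - 1) x"
  note defs = I0_def I1_def L0_def L1_def
  have pos: "I0 > 0" "I1 > 0" "L0 > 0" "L1 > 0"
    using assms \<nu> by (simp_all add: defs bessel_I_pos struve_L_pos)
  have "I0 * L1 - I1 * L0 > 0"
    using bessel_struve_cross_pos[OF assms, of \<nu>] \<nu> by (simp add: bessel_struve_cross_def defs)
  then show "struve_L \<nu> x / struve_L (\<nu> - 1) x < bessel_I \<nu> x / bessel_I (\<nu> - 1) x"
    unfolding defs[symmetric] using pos by (simp add: field_simps)
  have "I0 * L1 - I1 * L0 < struve_a \<nu> x * I0"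
    using upper \<nu> by (simp add: defs)
  \<comment> \<open>Division by the positive \<open>I0 * L0\<close>; taking reciprocals afterwards
    reverses the inequality and gives the lower bound.\<close>
  then have "L1 / L0 < I1 / I0 + struve_a \<nu> x / L0"
    using pos by (simp add: field_simps)
  also have "struve_a \<nu> x / L0 = 2 * struve_b \<nu> x / x"
    using assms by (simp add: struve_b_def L0_def)
  finally have "inverse (I1 / I0 + 2 * struve_b \<nu> x / x) < inverse (L1 / L0)"
    using pos by (intro less_imp_inverse_less) auto
  then show "inverse (bessel_I (\<nu> - 1) x / bessel_I \<nu> x + 2 * struve_b \<nu> x / x)
      < struve_L \<nu> x / struve_L (\<nu> - 1) x"
    by (simp add: defs)
qed

end
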